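(* Let $N\ge3$ and $p_0,p_1,p_2,p_3\in[0,1]$. Assume that the Markov chain in $\Sigma$ with one-step transition matrix $\boldsymbol P$ is ergodic with unique stationary distribution $\boldsymbol\pi$. Let $\{(\boldsymbol X(n),I(n))\}_{n\ge0}$ be the Markov chain in $\Sigma^*$ with one-step transition matrix $\boldsymbol P^*$, with an arbitrary initial distribution. Define $$\xi_n:=w((\boldsymbol X(n-1),I(n-1)),(\boldsymbol X(n),I(n))),\qquad n\ge1,$$ where $w$ is the payoff function (1 for a win and $-1$ for a loss), and let $S_n:=\xi_1+\cdots+\xi_n$ for each $n\ge1$. Then $n^{-1}S_n\to\mu^N$ a.s., where the mean parameter $\mu^N$ can be expressed in terms of $\boldsymbol\pi$ as $$\mu^N=\frac1N\sum_{\boldsymbol x\in\Sigma}\pi(\boldsymbol x)\sum_{i=1}^N[p_{m_i(\boldsymbol x)}-q_{m_i(\boldsymbol x)}],$$ in terms of the two-dimensional marginals $\pi_{1,3}=\pi_{2,4}=\cdots=\pi_{N-1,1}=\pi_{N,2}$ of $\boldsymbol\pi$ as $$\mu^N=\sum_{u=0}^1\sum_{v=0}^1\pi_{1,3}(u,v)(p_{2u+v}-q_{2u+v})=2[\pi_{1,3}(0,0)p_0+\pi_{1,3}(0,1)p_1+\pi_{1,3}(1,0)p_2+\pi_{1,3}(1,1)p_3]-1,$$ or in terms of the one-dimensional marginals $\pi_1=\pi_2=\cdots=\pi_N$ of $\boldsymbol\pi$ as $$\mu^N=\pi_1(1)-\pi_1(0)=2\pi_1(1)-1.$$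
   Context: Put $q_m:=1-p_m$. $\Sigma:=\{0,1\}^N$; for $\boldsymbol x=(x_1,\dots,x_N)\in\Sigma$ indices are cyclic ($x_0:=x_N$, $x_{N+1}:=x_1$), $m_i(\boldsymbol x):=2x_{i-1}+x_{i+1}\in\{0,1,2,3\}$, and $\boldsymbol x^i$ is $\boldsymbol x$ with the $i$th component replaced by $1-x_i$. $\boldsymbol P$ is given by $P(\boldsymbol x,\boldsymbol x^i)=N^{-1}p_{m_i(\boldsymbol x)}$ if $x_i=0$, $P(\boldsymbol x,\boldsymbol x^i)=N^{-1}q_{m_i(\boldsymbol x)}$ if $x_i=1$ ($i=1,\dots,N$), $P(\boldsymbol x,\boldsymbol x)=N^{-1}\big(\sum_{i:x_i=0}q_{m_i(\boldsymbol x)}+\sum_{i:x_i=1}p_{m_i(\boldsymbol x)}\big)$, and $P(\boldsymbol x,\boldsymbol y)=0$ otherwise. The chain is ergodic if it has a unique stationary distribution and the distribution at time $n$ converges to it as $n\to\infty$, whatever the initial distribution. $\Sigma^*:=\Sigma\times\{1,\dots,N\}$ (state $(\boldsymbol x,i)$: statuses $\boldsymbol x$, and $i$ is the next player to play). For all $(\boldsymbol x,i)\in\Sigma^*$ and $j=1,\dots,N$: $P^*((\boldsymbol x,i),(\boldsymbol x^i,j))=N^{-1}p_{m_i(\boldsymbol x)}$ if $x_i=0$ and $N^{-1}q_{m_i(\boldsymbol x)}$ if $x_i=1$; $P^*((\boldsymbol x,i),(\boldsymbol x,j))=N^{-1}q_{m_i(\boldsymbol x)}$ if $x_i=0$ and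 $N^{-1}p_{m_i(\boldsymbol x)}$ if $x_i=1$; all other entries are 0. The payoff $w((\boldsymbol x,i),(\boldsymbol y,j))$, for $\boldsymbol y\in\{\boldsymbol x,\boldsymbol x^i\}$, is $1$ if the corresponding entry of $\boldsymbol P^*$ is the one written $N^{-1}p_{m_i(\boldsymbol x)}$ above, and $-1$ if it is the one written $N^{-1}q_{m_i(\boldsymbol x)}$; equivalently it is $1$ if $y_i=1$ and $-1$ if $y_i=0$. Marginals: $\pi_{i,j}(u,v):=\pi\{\boldsymbol x:x_i=u,x_j=v\}$, $\pi_i(u):=\pi\{\boldsymbol x:x_i=u\}$. *)

theory Defs
  imports "HOL-Probability.Probability"
begin

text \<open>
  Finite-state Markov chains.  A transition matrix on a finite state space \<open>S\<close> is a function
  \<open>P :: 's \<Rightarrow> 's \<Rightarrow> real\<close> of which only the entries indexed by \<open>S \<times> S\<close> matter;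
  a distribution on \<open>S\<close> is a probability mass function supported in \<open>S\<close>.
\<close>

definition stationary :: "'s set \<Rightarrow> ('s \<Rightarrow> 's \<Rightarrow> real) \<Rightarrow> 's pmf \<Rightarrow> bool" where
  "stationary S P \<pi> \<longleftrightarrow>
     set_pmf \<pi> \<subseteq> S \<and> (\<forall>y\<in>S. (\<Sum>x\<in>S. pmf \<pi> x * P x y) = pmf \<pi> y)"

fun dist_at :: "'s set \<Rightarrow> ('s \<Rightarrow> 's \<Rightarrow> real) \<Rightarrow> 's pmf \<Rightarrow> nat \<Rightarrow> 's \<Rightarrow> real" where
  "dist_at S P \<nu> 0 y = pmf \<nu> y"
| "dist_at S P \<nu> (Suc n) y = (\<Sum>x\<in>S. dist_at S P \<nu> n x * P x y)"

definition ergodic :: "'s set \<Rightarrow> ('s \<Rightarrow> 's \<Rightarrow> real) \<Rightarrow> bool" where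
  "ergodic S P \<longleftrightarrow>
     (\<exists>\<pi>. stationary S P \<pi> \<and> (\<forall>\<pi>'. stationary S P \<pi>' \<longrightarrow> \<pi>' = \<pi>) \<and>
        (\<forall>\<nu>. set_pmf \<nu> \<subseteq> S \<longrightarrow> (\<forall>y\<in>S. (\<lambda>n. dist_at S P \<nu> n y) \<longlonglongrightarrow> pmf \<pi> y)))"

text \<open>The initial distribution, i.e. the law of \<open>Z 0\<close>, is unconstrained.\<close>

definition markov_chain ::
  "'w measure \<Rightarrow> 's set \<Rightarrow> ('s \<Rightarrow> 's \<Rightarrow> real) \<Rightarrow> (nat \<Rightarrow> 'w \<Rightarrow> 's) \<Rightarrow> bool" where
  "markov_chain M S P Z \<longleftrightarrow>
     prob_space M \<and> (\<forall>n. Z n \<in> measurable M (count_space S)) \<and>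
     (\<forall>n s. (\<forall>k\<le>Suc n. s k \<in> S) \<longrightarrow> \<P>(\<omega> in M. \<forall>k\<le>n. Z k \<omega> = s k) > 0 \<longrightarrow>
        \<P>(\<omega> in M. Z (Suc n) \<omega> = s (Suc n) \<bar> \<forall>k\<le>n. Z k \<omega> = s k) = P (s n) (s (Suc n)))"

definition configs :: "nat \<Rightarrow> (nat \<Rightarrow> nat) set" where
  "configs N = {1..N} \<rightarrow>\<^sub>E {0, 1}"

text \<open>Cyclic reduction to \<open>{1..N}\<close>, for indices between \<open>0\<close> and \<open>2 * N\<close>.\<close>

definition cyc :: "nat \<Rightarrow> nat \<Rightarrow> nat" where
  "cyc N k = (if k = 0 then N else if k > N then k - N else k)"

definition nbr :: "nat \<Rightarrow> nat \<Rightarrow> (nat \<Rightarrow> nat) \<Rightarrow> nat" where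
  "nbr N i x = 2 * x (cyc N (i - 1)) + x (cyc N (i + 1))"

definition flip :: "nat \<Rightarrow> (nat \<Rightarrow> nat) \<Rightarrow> (nat \<Rightarrow> nat)" where
  "flip i x = x(i := 1 - x i)"

abbreviation loss_prob :: "(nat \<Rightarrow> real) \<Rightarrow> nat \<Rightarrow> real" where
  "loss_prob p m \<equiv> 1 - p m"

text \<open>
  For \<open>y \<noteq> x\<close> there is at most one \<open>i\<close> with \<open>y = flip i x\<close>, so the sum in the second branch is
  either a single entry or \<open>0\<close>.
\<close>

definition trans_mat :: "nat \<Rightarrow> (nat \<Rightarrow> real) \<Rightarrow> (nat \<Rightarrow> nat) \<Rightarrow> (nat \<Rightarrow> nat) \<Rightarrow> real" where
  "trans_mat N p x y =
     (if y = x then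
        1 / real N * ((\<Sum>i | i \<in> {1..N} \<and> x i = 0. loss_prob p (nbr N i x)) +
                      (\<Sum>i | i \<in> {1..N} \<and> x i = 1. p (nbr N i x)))
      else
        (\<Sum>i | i \<in> {1..N} \<and> y = flip i x.
           1 / real N * (if x i = 0 then p (nbr N i x) else loss_prob p (nbr N i x))))"

definition configs_star :: "nat \<Rightarrow> ((nat \<Rightarrow> nat) \<times> nat) set" where
  "configs_star N = configs N \<times> {1..N}"

fun trans_star ::
  "nat \<Rightarrow> (nat \<Rightarrow> real) \<Rightarrow> (nat \<Rightarrow> nat) \<times> nat \<Rightarrow> (nat \<Rightarrow> nat) \<times> nat \<Rightarrow> real" where
  "trans_star N p (x, i) (y, j) =
     (if y = flip i x then
        1 / real N * (if x i = 0 then p (nbr N i x) else loss_prob p (nbr N i x))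
      else if y = x then
        1 / real N * (if x i = 0 then loss_prob p (nbr N i x) else p (nbr N i x))
      else 0)"

text \<open>
  The payoff is \<open>1\<close> on the entries of \<^const>\<open>trans_star\<close> involving \<open>p\<close> and \<open>-1\<close> on those involving
  \<open>loss_prob p\<close>.  The value \<open>0\<close> is a dummy for pairs of states that are not connected.
\<close>

fun payoff :: "(nat \<Rightarrow> nat) \<times> nat \<Rightarrow> (nat \<Rightarrow> nat) \<times> nat \<Rightarrow> real" where
  "payoff (x, i) (y, j) =
     (if (y = flip i x \<and> x i = 0) \<or> (y = x \<and> x i = 1) then 1
      else if (y = flip i x \<and> x i = 1) \<or> (y = x \<and> x i = 0) then -1
      else 0)"

lemma payoff_alt:
  assumes "(x, i) \<in> configs_star N" "y \<in> {x, flip i x}"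
  shows "payoff (x, i) (y, j) = (if y i = 1 then 1 else -1)"
proof -
  have "x i \<in> {0, 1}"
    using assms(1) by (auto simp: configs_star_def configs_def PiE_iff)
  then show ?thesis
    using assms(2) by (auto simp: flip_def fun_eq_iff)
qed

definition marg1 :: "(nat \<Rightarrow> nat) pmf \<Rightarrow> nat \<Rightarrow> nat \<Rightarrow> real" where
  "marg1 \<pi> i u = measure_pmf.prob \<pi> {x. x i = u}"

definition marg2 :: "(nat \<Rightarrow> nat) pmf \<Rightarrow> nat \<Rightarrow> nat \<Rightarrow> nat \<Rightarrow> nat \<Rightarrow> real" where
  "marg2 \<pi> i j u v = measure_pmf.prob \<pi> {x. x i = u \<and> x j = v}"

end

theory Submission
  imports Defs "HOL-Library.Discrete_Functions"
begin

text \<open>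
  Every identity for the mean parameter comes from one property of the chain: a move
  replaces the status of a uniformly chosen player \<open>i\<close> by a coin with success probability
  \<open>p (nbr N i x)\<close>, whatever the old status was (lemma \<open>sum_play\<close>).  Stationarity of the indicator
  of \<open>x i = 1\<close> therefore says that the marginal \<open>\<pi>\<^sub>i(1)\<close> equals the mean of
  \<open>p (nbr N i x)\<close> under \<open>\<pi>\<close> (lemma \<open>marg1_eq_mean_win\<close>), the stationary probability that player
  \<open>i\<close> wins when playing.  Since \<open>nbr N i x\<close> is a function of the two neighbours of \<open>i\<close>, that mean is
  also an expression in a two-dimensional marginal.  The transition matrix commutes with the rotation
  of the players, so uniqueness makes \<open>\<pi>\<close> rotation invariant, and the marginals do not depend
  on the position.

  The almost sure limit is a strong law for a finite Markov chain \<open>Z\<close> and a payoff \<open>w\<close> attached to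
  its transitions (lemma \<open>markov_chain_slln\<close>).  Let \<open>f\<close> be the conditional mean payoff from a
  state and \<open>Q\<close> the transition operator, and suppose that \<open>Q\<^sup>n f\<close> tends to a constant
  \<open>\<mu>\<close>.  With \<open>h = f + Q f + \<dots> + Q\<^sup>m\<^sup>-\<^sup>1 f\<close> one has \<open>f = h - Q h + Q\<^sup>m f\<close>, an approximate
  Poisson equation.  It splits the total payoff into bounded martingale differences, a bounded
  boundary term, and a sum of values of \<open>Q\<^sup>m f\<close>, which are uniformly close to \<open>\<mu>\<close> for large \<open>m\<close>.
  Since \<open>m\<close> is fixed before averaging, convergence without a rate suffices.  Martingale
  differences are orthogonal, so their averages vanish almost surely by a second moment argument
  (lemma \<open>slln_bounded_orthogonal\<close>).

  It remains to transfer convergence from the original chain to the chain on \<open>configs_star N\<close>, which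
  also records the next player.  The next player is chosen uniformly and independently of everything
  else, so summing over the player intertwines the two transition operators
  (lemma \<open>sum_players_mean_next_star\<close>); after one step the augmented chain sees only such sums.
\<close>

section \<open>A strong law for bounded orthogonal sequences\<close>

text \<open>
  Orthogonality makes the second moment of the \<open>n\<close>-th partial sum at most \<open>n C\<^sup>2\<close>, so the
  squared averages along \<open>n = r\<^sup>2\<close> have summable expectations and tend to \<open>0\<close> almost surely.
  Between consecutive squares the partial sums move by at most \<open>2 r C\<close>, which is negligible
  compared with \<open>r\<^sup>2\<close>.
\<close>

lemma slln_bounded_orthogonal:
  fixes D :: "nat \<Rightarrow> 'w \<Rightarrow> real"
  assumes "prob_space M"
    and meas: "\<And>n. D n \<in> borel_measurable M"
    and bound: "\<And>n \<omega>. \<omega> \<in> space M \<Longrightarrow> \<bar>D n \<omega>\<bar> \<le> C"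
    and orth: "\<And>j k. j < k \<Longrightarrow> (\<integral>\<omega>. D j \<omega> * D k \<omega> \<partial>M) = 0"
  shows "AE \<omega> in M. (\<lambda>n. (\<Sum>k<n. D k \<omega>) / real n) \<longlonglongrightarrow> 0"
proof -
  interpret prob_space M by fact
  define T where "T n \<omega> = (\<Sum>k<n. D k \<omega>)" for n \<omega>
  have C0: "0 \<le> C"
    using not_empty bound[of _ 0] by (metis abs_ge_zero all_not_in_conv order_trans)
  have T_meas [measurable]: "T n \<in> borel_measurable M" for n
    unfolding T_def using meas by measurable
  note meas [measurable]
  have T_bound: "\<bar>T n \<omega>\<bar> \<le> real n * C" if "\<omega> \<in> space M" for n \<omega>
    using sum_bounded_above[of "{..<n}" "\<lambda>k. \<bar>D k \<omega>\<bar>" C] bound[OF that]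
    unfolding T_def by (intro order_trans[OF sum_abs]) auto
  have prod_int: "integrable M (\<lambda>\<omega>. D j \<omega> * D k \<omega>)" for j k
  proof (rule integrable_const_bound[where B = "C * C"])
    show "AE \<omega> in M. norm (D j \<omega> * D k \<omega>) \<le> C * C"
      using bound C0 by (intro AE_I2) (auto simp: abs_mult intro!: mult_mono)
  qed measurable
  have T_int: "integrable M (\<lambda>\<omega>. (T n \<omega>)\<^sup>2)" for n
  proof (rule integrable_const_bound[where B = "(real n * C)\<^sup>2"])
    show "AE \<omega> in M. norm ((T n \<omega>)\<^sup>2) \<le> (real n * C)\<^sup>2"
      using T_bound[of _ n] C0 by (intro AE_I2) (auto intro!: abs_le_square_iff[THEN iffD1] simp: abs_mult)
  qed measurable
  have second_moment: "(\<integral>\<omega>. (T n \<omega>)\<^sup>2 \<partial>M) \<le> real n * C\<^sup>2" for n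
  proof (induction n)
    case 0
    then show ?case by (simp add: T_def)
  next
    case (Suc n)
    have cross: "(\<integral>\<omega>. (\<Sum>k<n. D k \<omega> * D n \<omega>) \<partial>M) = 0"
      using prod_int orth by (subst Bochner_Integration.integral_sum) auto
    have cross_int: "integrable M (\<lambda>\<omega>. (\<Sum>k<n. D k \<omega> * D n \<omega>))"
      using prod_int by auto
    have "(\<integral>\<omega>. (T (Suc n) \<omega>)\<^sup>2 \<partial>M)
        = (\<integral>\<omega>. (T n \<omega>)\<^sup>2 + 2 * (\<Sum>k<n. D k \<omega> * D n \<omega>) + D n \<omega> * D n \<omega> \<partial>M)"
      by (intro Bochner_Integration.integral_cong)
        (auto simp: T_def power2_eq_square algebra_simps sum_distrib_left)
    also have "\<dots> = (\<integral>\<omega>. (T n \<omega>)\<^sup>2 \<partial>M) + (\<integral>\<omega>. D n \<omega> * D n \<omega> \<partial>M)"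
      using T_int[of n] prod_int[of n n] cross_int cross by simp
    also have "(\<integral>\<omega>. D n \<omega> * D n \<omega> \<partial>M) \<le> (\<integral>\<omega>. C\<^sup>2 \<partial>M)"
    proof (intro integral_mono prod_int)
      fix \<omega> assume "\<omega> \<in> space M"
      then have "\<bar>D n \<omega>\<bar> * \<bar>D n \<omega>\<bar> \<le> C * C"
        using bound C0 by (intro mult_mono) auto
      then show "D n \<omega> * D n \<omega> \<le> C\<^sup>2" by (simp add: power2_eq_square)
    qed auto
    finally show ?case using Suc by (simp add: prob_space algebra_simps)
  qed
  \<comment> \<open>The shift by one keeps the square in the denominator positive.\<close>
  define Y where "Y r \<omega> = (T ((Suc r)\<^sup>2) \<omega> / real ((Suc r)\<^sup>2))\<^sup>2" for r \<omega>
  have Y_meas [measurable]: "Y r \<in> borel_measurable M" for r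
    unfolding Y_def by measurable
  have Y_int: "integrable M (Y r)" for r
    unfolding Y_def power_divide by (intro integrable_divide T_int)
  have Y_le: "(\<integral>\<omega>. Y r \<omega> \<partial>M) \<le> C\<^sup>2 * inverse ((real (Suc r))\<^sup>2)" for r
  proof -
    have "(\<integral>\<omega>. Y r \<omega> \<partial>M) = (\<integral>\<omega>. (T ((Suc r)\<^sup>2) \<omega>)\<^sup>2 \<partial>M) / (real ((Suc r)\<^sup>2))\<^sup>2"
      unfolding Y_def power_divide by simp
    also have "\<dots> \<le> (real ((Suc r)\<^sup>2) * C\<^sup>2) / (real ((Suc r)\<^sup>2))\<^sup>2"
      by (intro divide_right_mono second_moment) auto
    also have "\<dots> = C\<^sup>2 * inverse ((real (Suc r))\<^sup>2)"
      unfolding of_nat_power by (simp add: power2_eq_square divide_simps del: of_nat_Suc)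
    finally show ?thesis .
  qed
  have summ: "summable (\<lambda>r. C\<^sup>2 * inverse ((real (Suc r))\<^sup>2))"
    by (intro summable_mult iffD2[OF summable_Suc_iff] inverse_power_summable) simp
  have "(\<integral>\<^sup>+\<omega>. (\<Sum>r. ennreal (Y r \<omega>)) \<partial>M) = (\<Sum>r. \<integral>\<^sup>+\<omega>. ennreal (Y r \<omega>) \<partial>M)"
    by (intro nn_integral_suminf) measurable
  also have "\<dots> = (\<Sum>r. ennreal (\<integral>\<omega>. Y r \<omega> \<partial>M))"
    by (intro suminf_cong nn_integral_eq_integral Y_int) (simp add: Y_def)
  also have "\<dots> \<le> (\<Sum>r. ennreal (C\<^sup>2 * inverse ((real (Suc r))\<^sup>2)))"
    by (intro suminf_le ennreal_leI Y_le) auto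
  also have "\<dots> < \<infinity>"
    using summ by (simp add: ennreal_suminf_neq_top less_top)
  finally have "(\<integral>\<^sup>+\<omega>. (\<Sum>r. ennreal (Y r \<omega>)) \<partial>M) \<noteq> \<infinity>" by simp
  then have "AE \<omega> in M. (\<Sum>r. ennreal (Y r \<omega>)) \<noteq> \<infinity>"
    by (intro nn_integral_PInf_AE) measurable
  then show ?thesis
  proof (rule AE_mp, intro AE_I2 impI)
    fix \<omega> assume \<omega>: "\<omega> \<in> space M" and fin: "(\<Sum>r. ennreal (Y r \<omega>)) \<noteq> \<infinity>"
    have "summable (\<lambda>r. Y r \<omega>)"
      using fin by (intro summable_suminf_not_top) (auto simp: Y_def)
    then have "(\<lambda>r. Y r \<omega>) \<longlonglongrightarrow> 0" by (rule summable_LIMSEQ_zero)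
    then have "(\<lambda>r. sqrt (Y r \<omega>)) \<longlonglongrightarrow> 0"
      using tendsto_real_sqrt by fastforce
    then have "(\<lambda>r. \<bar>T ((Suc r)\<^sup>2) \<omega> / real ((Suc r)\<^sup>2)\<bar>) \<longlonglongrightarrow> 0"
      by (simp only: Y_def real_sqrt_abs)
    then have squares: "(\<lambda>r. \<bar>T (r\<^sup>2) \<omega> / real (r\<^sup>2)\<bar>) \<longlonglongrightarrow> 0"
      by (rule LIMSEQ_imp_Suc)
    have "(\<lambda>r. 2 * C / real r) \<longlonglongrightarrow> 0" by (rule lim_const_over_n)
    from tendsto_add[OF squares this]
    have lim: "(\<lambda>r. \<bar>T (r\<^sup>2) \<omega> / real (r\<^sup>2)\<bar> + 2 * C / real r) \<longlonglongrightarrow> 0" by simp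
    \<comment> \<open>Every time \<open>k\<close> is compared with the largest square \<open>r\<^sup>2\<close> not exceeding it.\<close>
    have "filterlim floor_sqrt at_top sequentially"
      unfolding filterlim_at_top
    proof
      fix z :: nat
      show "\<forall>\<^sub>F k in sequentially. z \<le> floor_sqrt k"
        using eventually_ge_at_top[of "z\<^sup>2"]
        by eventually_elim (rule le_floor_sqrtI)
    qed
    from filterlim_compose[OF lim this]
    have lim': "(\<lambda>k. \<bar>T ((floor_sqrt k)\<^sup>2) \<omega> / real ((floor_sqrt k)\<^sup>2)\<bar>
        + 2 * C / real (floor_sqrt k)) \<longlonglongrightarrow> 0" .
    have "(\<lambda>n. T n \<omega> / real n) \<longlonglongrightarrow> 0"
    proof (rule Lim_null_comparison[OF _ lim'])
      show "\<forall>\<^sub>F k in sequentially. norm (T k \<omega> / real k)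
         \<le> \<bar>T ((floor_sqrt k)\<^sup>2) \<omega> / real ((floor_sqrt k)\<^sup>2)\<bar> + 2 * C / real (floor_sqrt k)"
        using eventually_gt_at_top[of 0]
      proof eventually_elim
        case (elim k)
        define r where "r = floor_sqrt k"
        have r0: "0 < r" using elim by (simp add: r_def)
        have r_le: "r\<^sup>2 \<le> k" by (simp add: r_def)
        have k_le: "k \<le> r\<^sup>2 + 2 * r"
          using Suc_floor_sqrt_power2_gt[of k] by (simp add: r_def power2_eq_square)
        have split: "T k \<omega> = T (r\<^sup>2) \<omega> + (\<Sum>j\<in>{r\<^sup>2..<k}. D j \<omega>)"
          unfolding T_def lessThan_atLeast0
          by (rule sum.atLeastLessThan_concat[OF le0 r_le, symmetric])
        have "\<bar>\<Sum>j\<in>{r\<^sup>2..<k}. D j \<omega>\<bar> \<le> real (card {r\<^sup>2..<k}) * C"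
          using bound[OF \<omega>] by (intro order_trans[OF sum_abs] sum_bounded_above)
        also have "\<dots> \<le> real (2 * r) * C"
          using k_le C0 by (intro mult_right_mono) auto
        finally have "\<bar>T k \<omega>\<bar> \<le> \<bar>T (r\<^sup>2) \<omega>\<bar> + 2 * real r * C"
          unfolding split by simp
        then have "\<bar>T k \<omega>\<bar> / real k \<le> (\<bar>T (r\<^sup>2) \<omega>\<bar> + 2 * real r * C) / real (r\<^sup>2)"
          using r_le r0 C0 by (intro frac_le) (simp_all only: of_nat_le_iff, auto)
        also have "\<dots> = \<bar>T (r\<^sup>2) \<omega> / real (r\<^sup>2)\<bar> + 2 * C / real r"
          using r0 by (simp add: add_divide_distrib power2_eq_square)
        finally show ?case by (simp add: r_def)
      qed
    qed
    then show "(\<lambda>n. (\<Sum>k<n. D k \<omega>) / real n) \<longlonglongrightarrow> 0" by (simp add: T_def)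
  qed
qed

section \<open>A strong law for finite Markov chains\<close>

lemma (in prob_space) finite_valued_expectation:
  fixes F :: "'t \<Rightarrow> real"
  assumes "finite T" and W: "W \<in> measurable M (count_space T)"
  shows "integrable M (\<lambda>\<omega>. F (W \<omega>))"
    and "(\<integral>\<omega>. F (W \<omega>) \<partial>M) = (\<Sum>t\<in>T. F t * prob {\<omega> \<in> space M. W \<omega> = t})"
proof -
  have ev [measurable]: "{\<omega> \<in> space M. W \<omega> = t} \<in> events" if "t \<in> T" for t
    using measurable_sets[OF W, of "{t}"] that by (simp add: vimage_def Int_def conj_commute)
  have eq: "F (W \<omega>) = (\<Sum>t\<in>T. F t * indicator {\<omega> \<in> space M. W \<omega> = t} \<omega>)"
    if "\<omega> \<in> space M" for \<omega>
    using that measurable_space[OF W that] \<open>finite T\<close>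
    by (subst sum.remove[of _ "W \<omega>"]) (auto intro!: sum.neutral)
  have int: "integrable M (\<lambda>\<omega>. F t * indicator {\<omega> \<in> space M. W \<omega> = t} \<omega>)" if "t \<in> T" for t
    using ev[OF that] by (intro integrable_mult_right integrable_real_indicator) (auto simp: emeasure_eq_measure)
  show "integrable M (\<lambda>\<omega>. F (W \<omega>))"
    using int by (subst Bochner_Integration.integrable_cong[OF refl eq]) auto
  have "(\<integral>\<omega>. F (W \<omega>) \<partial>M) = (\<Sum>t\<in>T. \<integral>\<omega>. F t * indicator {\<omega> \<in> space M. W \<omega> = t} \<omega> \<partial>M)"
    using int by (subst Bochner_Integration.integral_cong[OF refl eq])
      (auto intro!: Bochner_Integration.integral_sum)
  also have "\<dots> = (\<Sum>t\<in>T. F t * prob {\<omega> \<in> space M. W \<omega> = t})"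
    using ev by (intro sum.cong) (auto simp: Int_absorb2)
  finally show "(\<integral>\<omega>. F (W \<omega>) \<partial>M) = (\<Sum>t\<in>T. F t * prob {\<omega> \<in> space M. W \<omega> = t})" .
qed

lemma measurable_Pair_finite:
  assumes "finite A" "finite B"
    and "f \<in> measurable M (count_space A)" "g \<in> measurable M (count_space B)"
  shows "(\<lambda>\<omega>. (f \<omega>, g \<omega>)) \<in> measurable M (count_space (A \<times> B))"
  using measurable_Pair[OF assms(3,4)]
  unfolding pair_measure_countable[OF countable_finite[OF assms(1)] countable_finite[OF assms(2)]] .

text \<open>
  Restriction to \<open>{..n}\<close> makes the past a random element of a finite set when the state space is
  finite, so expectations become finite sums.
\<close>

definition history :: "(nat \<Rightarrow> 'w \<Rightarrow> 's) \<Rightarrow> nat \<Rightarrow> 'w \<Rightarrow> nat \<Rightarrow> 's" where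
  "history Z n \<omega> = (\<lambda>k\<in>{..n}. Z k \<omega>)"

lemma history_eq_iff:
  assumes "s \<in> {..n} \<rightarrow>\<^sub>E S"
  shows "history Z n \<omega> = s \<longleftrightarrow> (\<forall>k\<le>n. Z k \<omega> = s k)"
proof
  assume "\<forall>k\<le>n. Z k \<omega> = s k"
  then show "history Z n \<omega> = s"
    unfolding history_def by (intro extensionalityI[of _ "{..n}"] restrict_extensional PiE_ext[of _ "{..n}" "\<lambda>_. S"])
      (use assms in \<open>auto simp: PiE_iff\<close>)
qed (auto simp: history_def)

lemma measurable_history:
  assumes "finite S" and Z: "\<And>n. Z n \<in> measurable M (count_space S)"
  shows "history Z n \<in> measurable M (count_space ({..n} \<rightarrow>\<^sub>E S))"
proof -
  have "history Z n -` {s} \<inter> space M \<in> sets M" if s: "s \<in> {..n} \<rightarrow>\<^sub>E S" for s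
  proof -
    have "history Z n -` {s} \<inter> space M = (\<Inter>k\<in>{..n}. Z k -` {s k} \<inter> space M)"
      using history_eq_iff[OF s, of Z] by auto
    also have "\<dots> \<in> sets M"
      using s by (intro sets.finite_INT measurable_sets[OF Z]) (auto simp: PiE_iff)
    finally show ?thesis .
  qed
  moreover have "history Z n \<in> space M \<rightarrow> ({..n} \<rightarrow>\<^sub>E S)"
    using measurable_space[OF Z] by (auto simp: history_def)
  ultimately show ?thesis
    using \<open>finite S\<close> by (subst measurable_count_space_eq2) (auto intro!: finite_PiE)
qed

text \<open>
  The Markov property of the definition conditions on histories of positive probability.  In product
  form it holds for all histories, as both sides vanish on null ones, and it can then be summed.
\<close>

lemma markov_chain_prob_step:
  assumes mc: "markov_chain M S P Z" and "finite S"
    and s: "s \<in> {..n} \<rightarrow>\<^sub>E S" and y: "y \<in> S"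
  shows "measure M {\<omega> \<in> space M. (history Z n \<omega>, Z (Suc n) \<omega>) = (s, y)}
    = measure M {\<omega> \<in> space M. history Z n \<omega> = s} * P (s n) y"
proof -
  interpret prob_space M using mc by (simp add: markov_chain_def)
  define E where "E = {\<omega> \<in> space M. \<forall>k\<le>n. Z k \<omega> = s k}"
  define E' where "E' = {\<omega> \<in> space M. Z (Suc n) \<omega> = y \<and> (\<forall>k\<le>n. Z k \<omega> = s k)}"
  have hist: "{\<omega> \<in> space M. history Z n \<omega> = s} = E"
    using history_eq_iff[OF s, of Z] by (auto simp: E_def)
  have hist': "{\<omega> \<in> space M. (history Z n \<omega>, Z (Suc n) \<omega>) = (s, y)} = E'"
    using history_eq_iff[OF s, of Z] by (auto simp: E'_def)
  have E_ev: "E \<in> events"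
    using measurable_sets[OF measurable_history[of S Z M n], of "{s}"] mc \<open>finite S\<close> s hist
    by (simp add: markov_chain_def vimage_def Int_def conj_commute)
  have "prob E' = prob E * P (s n) y"
  proof (cases "prob E > 0")
    case True
    have "\<forall>k\<le>Suc n. (s(Suc n := y)) k \<in> S"
      using s y by (auto simp: PiE_iff le_Suc_eq)
    moreover have "{\<omega> \<in> space M. \<forall>k\<le>n. Z k \<omega> = (s(Suc n := y)) k} = E"
      by (auto simp: E_def)
    ultimately have "cond_prob M (\<lambda>\<omega>. Z (Suc n) \<omega> = (s(Suc n := y)) (Suc n))
        (\<lambda>\<omega>. \<forall>k\<le>n. Z k \<omega> = (s(Suc n := y)) k) = P ((s(Suc n := y)) n) ((s(Suc n := y)) (Suc n))"
      using mc[unfolded markov_chain_def, THEN conjunct2, THEN conjunct2, rule_format, of n "s(Suc n := y)"] True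
      by simp
    then have "prob E' / prob E = P (s n) y"
      by (simp add: cond_prob_def E_def E'_def cong: conj_cong)
    then show ?thesis using True by (simp add: field_simps)
  next
    case False
    then have "prob E = 0" by (simp add: zero_less_measure_iff)
    moreover have "prob E' \<le> prob E"
      by (rule finite_measure_mono[OF _ E_ev]) (unfold E_def E'_def, blast)
    ultimately show ?thesis
      using measure_nonneg[of M E'] by simp
  qed
  then show ?thesis unfolding hist hist' .
qed

text \<open>
  This is the martingale difference property: subtracting from a function of the current transition
  its conditional mean leaves a variable orthogonal to every function of the past.
\<close>

lemma markov_chain_compensator:
  fixes V :: "'s \<Rightarrow> 's \<Rightarrow> real" and \<phi> :: "(nat \<Rightarrow> 's) \<Rightarrow> real"
  assumes mc: "markov_chain M S P Z" and fin: "finite S"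
  shows "(\<integral>\<omega>. \<phi> (history Z n \<omega>) *
      (V (Z n \<omega>) (Z (Suc n) \<omega>) - (\<Sum>y\<in>S. P (Z n \<omega>) y * V (Z n \<omega>) y)) \<partial>M) = 0"
proof -
  interpret prob_space M using mc by (simp add: markov_chain_def)
  define H where "H = ({..n} \<rightarrow>\<^sub>E S)"
  have Z: "Z k \<in> measurable M (count_space S)" for k
    using mc by (simp add: markov_chain_def)
  have finH: "finite H" using fin by (auto simp: H_def intro!: finite_PiE)
  have hist: "history Z n \<in> measurable M (count_space H)"
    unfolding H_def using fin Z by (rule measurable_history)
  note pair = measurable_Pair_finite[OF finH fin hist Z[of "Suc n"]]
  have now: "Z n \<omega> = history Z n \<omega> n" for \<omega> by (simp add: history_def)
  define G where "G s = \<phi> s * (\<Sum>y\<in>S. P (s n) y * V (s n) y)" for s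
  define F where "F = (\<lambda>(s, y). \<phi> s * V (s n) y)"
  have "(\<integral>\<omega>. F (history Z n \<omega>, Z (Suc n) \<omega>) \<partial>M)
      = (\<Sum>(s, y)\<in>H \<times> S. \<phi> s * V (s n) y *
          prob {\<omega> \<in> space M. (history Z n \<omega>, Z (Suc n) \<omega>) = (s, y)})"
    unfolding finite_valued_expectation(2)[OF finite_cartesian_product[OF finH fin] pair]
    by (intro sum.cong) (auto simp: F_def)
  also have "\<dots> = (\<Sum>(s, y)\<in>H \<times> S. \<phi> s * V (s n) y *
          (prob {\<omega> \<in> space M. history Z n \<omega> = s} * P (s n) y))"
    using markov_chain_prob_step[OF mc fin, of _ n] by (intro sum.cong) (auto simp: H_def)
  also have "\<dots> = (\<Sum>s\<in>H. G s * prob {\<omega> \<in> space M. history Z n \<omega> = s})"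
    unfolding G_def sum.cartesian_product[symmetric]
    by (intro sum.cong) (auto simp: sum_distrib_left sum_distrib_right algebra_simps)
  also have "\<dots> = (\<integral>\<omega>. G (history Z n \<omega>) \<partial>M)"
    by (rule finite_valued_expectation(2)[OF finH hist, symmetric])
  finally have "(\<integral>\<omega>. F (history Z n \<omega>, Z (Suc n) \<omega>) - G (history Z n \<omega>) \<partial>M) = 0"
    using finite_valued_expectation(1)[OF finite_cartesian_product[OF finH fin] pair, of F]
      finite_valued_expectation(1)[OF finH hist, of G] by simp
  then show ?thesis
    unfolding F_def G_def by (simp add: now algebra_simps)
qed

definition mean_next :: "'s set \<Rightarrow> ('s \<Rightarrow> 's \<Rightarrow> real) \<Rightarrow> ('s \<Rightarrow> real) \<Rightarrow> 's \<Rightarrow> real" where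
  "mean_next S P h x = (\<Sum>y\<in>S. P x y * h y)"

lemma mean_next_cong:
  "(\<And>y. y \<in> S \<Longrightarrow> g y = h y) \<Longrightarrow> mean_next S P g x = mean_next S P h x"
  by (simp add: mean_next_def)

lemma mean_next_sum: "mean_next S P (\<lambda>x. \<Sum>a\<in>A. h a x) x = (\<Sum>a\<in>A. mean_next S P (h a) x)"
  unfolding mean_next_def sum_distrib_left by (rule sum.swap)

text \<open>
  The martingale differences \<open>d m\<close> are those of the payoff corrected by the truncated Poisson solution
  \<open>h m\<close>, whose increments telescope along the path.  The exceptional null set is chosen for all \<open>m\<close>
  at once, so that \<open>m\<close> may depend on the required accuracy.
\<close>

lemma markov_chain_slln:
  fixes w :: "'s \<Rightarrow> 's \<Rightarrow> real"
  assumes mc: "markov_chain M S P Z" and fin: "finite S"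
    and lim: "\<And>x. x \<in> S \<Longrightarrow>
      (\<lambda>n. (mean_next S P ^^ n) (\<lambda>x. \<Sum>y\<in>S. P x y * w x y) x) \<longlonglongrightarrow> \<mu>"
  shows "AE \<omega> in M. (\<lambda>n. (\<Sum>k<n. w (Z k \<omega>) (Z (Suc k) \<omega>)) / real n) \<longlonglongrightarrow> \<mu>"
proof -
  interpret prob_space M using mc by (simp add: markov_chain_def)
  have Z: "Z k \<in> measurable M (count_space S)" for k
    using mc by (simp add: markov_chain_def)
  have Z_in: "Z k \<omega> \<in> S" if "\<omega> \<in> space M" for k \<omega>
    using measurable_space[OF Z that] by simp
  define f where "f x = (\<Sum>y\<in>S. P x y * w x y)" for x
  \<comment> \<open>\<open>h m\<close> solves the Poisson equation for \<open>f\<close> up to the error \<open>Q m\<close>, as \<open>V_mean\<close> shows.\<close>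
  define Q where "Q m = (mean_next S P ^^ m) f" for m
  define h where "h m x = (\<Sum>r<m. Q r x)" for m x
  define V where "V m x y = w x y + h m y" for m x y
  define d where "d m x y = V m x y - (\<Sum>z\<in>S. P x z * V m x z)" for m x y
  have V_mean: "(\<Sum>z\<in>S. P x z * V m x z) = h m x + Q m x" for m x
  proof -
    have "(\<Sum>z\<in>S. P x z * V m x z) = f x + mean_next S P (h m) x"
      by (simp add: V_def f_def mean_next_def algebra_simps sum.distrib)
    also have "mean_next S P (h m) x = (\<Sum>r<m. Q (Suc r) x)"
      using mean_next_sum[of S P Q "{..<m}" x] by (simp add: h_def[abs_def] Q_def)
    also have "f x + (\<Sum>r<m. Q (Suc r) x) = (\<Sum>r<Suc m. Q r x)"
      by (subst sum.lessThan_Suc_shift) (simp add: Q_def)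
    finally show ?thesis by (simp add: h_def)
  qed
  have D_avg: "AE \<omega> in M. (\<lambda>n. (\<Sum>k<n. d m (Z k \<omega>) (Z (Suc k) \<omega>)) / real n) \<longlonglongrightarrow> 0" for m
  proof (rule slln_bounded_orthogonal)
    show "prob_space M" by unfold_locales
    show "(\<lambda>\<omega>. d m (Z n \<omega>) (Z (Suc n) \<omega>)) \<in> borel_measurable M" for n
      using finite_valued_expectation(1)[OF finite_cartesian_product[OF fin fin]
          measurable_Pair_finite[OF fin fin Z Z], of "case_prod (d m)" n "Suc n"]
      by (simp add: borel_measurable_integrable)
    show "\<bar>d m (Z n \<omega>) (Z (Suc n) \<omega>)\<bar> \<le> (\<Sum>(x, y)\<in>S \<times> S. \<bar>d m x y\<bar>)"
      if "\<omega> \<in> space M" for n \<omega>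
      using member_le_sum[of "(Z n \<omega>, Z (Suc n) \<omega>)" "S \<times> S" "\<lambda>(x, y). \<bar>d m x y\<bar>"]
        fin Z_in[OF that] by auto
    show "(\<integral>\<omega>. d m (Z j \<omega>) (Z (Suc j) \<omega>) * d m (Z k \<omega>) (Z (Suc k) \<omega>) \<partial>M) = 0"
      if "j < k" for j k
      using markov_chain_compensator[OF mc fin, of "\<lambda>s. d m (s j) (s (Suc j))" k "V m"] that
      by (simp add: history_def d_def[of m "Z k _"])
  qed
  have "AE \<omega> in M. \<forall>m. (\<lambda>n. (\<Sum>k<n. d m (Z k \<omega>) (Z (Suc k) \<omega>)) / real n) \<longlonglongrightarrow> 0"
    using D_avg by (subst AE_all_countable) blast
  then show ?thesis
  proof (rule AE_mp, intro AE_I2 impI)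
    fix \<omega> assume \<omega>: "\<omega> \<in> space M"
      and D0: "\<forall>m. (\<lambda>n. (\<Sum>k<n. d m (Z k \<omega>) (Z (Suc k) \<omega>)) / real n) \<longlonglongrightarrow> 0"
    let ?z = "\<lambda>k. Z k \<omega>"
    show "(\<lambda>n. (\<Sum>k<n. w (?z k) (?z (Suc k))) / real n) \<longlonglongrightarrow> \<mu>"
    proof (rule metric_LIMSEQ_I, goal_cases)
      case (1 e)
      have "\<forall>\<^sub>F m in sequentially. dist (Q m x) \<mu> < e / 3" if "x \<in> S" for x
        using tendstoD[OF lim[OF that], of "e / 3"] \<open>e > 0\<close>
        unfolding Q_def f_def[abs_def] by simp
      then have "\<forall>\<^sub>F m in sequentially. \<forall>x\<in>S. dist (Q m x) \<mu> < e / 3"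
        using fin by (intro eventually_ball_finite) blast+
      then obtain m where "\<forall>x\<in>S. dist (Q m x) \<mu> < e / 3"
        using eventually_happens'[OF sequentially_bot] by blast
      then have m: "\<bar>Q m x - \<mu>\<bar> < e / 3" if "x \<in> S" for x
        using that by (simp add: dist_real_def)
      define B where "B = (\<Sum>x\<in>S. \<bar>h m x\<bar>)"
      have B: "\<bar>h m x\<bar> \<le> B" if "x \<in> S" for x
        using member_le_sum[of x S "\<lambda>x. \<bar>h m x\<bar>"] that fin by (simp add: B_def)
      have decomp: "(\<Sum>k<n. w (?z k) (?z (Suc k))) =
          (\<Sum>k<n. d m (?z k) (?z (Suc k))) + (h m (?z 0) - h m (?z n)) + (\<Sum>k<n. Q m (?z k))" for n
        by (induction n) (simp_all add: d_def V_mean, simp add: V_def)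
      have "\<forall>\<^sub>F n in sequentially. \<bar>2 * B / real n\<bar> < e / 3"
        using tendstoD[OF lim_const_over_n[of "2 * B"], of "e / 3"] \<open>e > 0\<close>
        unfolding dist_real_def diff_0_right by simp
      moreover have "\<forall>\<^sub>F n in sequentially. \<bar>(\<Sum>k<n. d m (?z k) (?z (Suc k))) / real n\<bar> < e / 3"
        using tendstoD[OF D0[rule_format, of m], of "e / 3"] \<open>e > 0\<close>
        unfolding dist_real_def diff_0_right by simp
      ultimately have "\<forall>\<^sub>F n in sequentially. dist ((\<Sum>k<n. w (?z k) (?z (Suc k))) / real n) \<mu> < e"
        using eventually_gt_at_top[of 0]
      proof eventually_elim
        case (elim n)
        have "(\<Sum>k<n. \<bar>Q m (?z k) - \<mu>\<bar>) \<le> real (card {..<n}) * (e / 3)"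
          using m[OF Z_in[OF \<omega>]] by (intro sum_bounded_above less_imp_le)
        then have "\<bar>\<Sum>k<n. Q m (?z k) - \<mu>\<bar> \<le> real n * (e / 3)"
          by (intro order_trans[OF sum_abs]) simp
        moreover have "(\<Sum>k<n. Q m (?z k)) / real n - \<mu> = (\<Sum>k<n. Q m (?z k) - \<mu>) / real n"
          using elim by (simp add: sum_subtractf diff_divide_distrib)
        ultimately have mean: "\<bar>(\<Sum>k<n. Q m (?z k)) / real n - \<mu>\<bar> \<le> e / 3"
          using elim by (simp add: abs_divide pos_divide_le_eq mult.commute)
        have "\<bar>h m (?z 0) - h m (?z n)\<bar> \<le> 2 * B"
          using B[OF Z_in[OF \<omega>], of 0] B[OF Z_in[OF \<omega>], of n] by linarith
        then have boundary: "\<bar>(h m (?z 0) - h m (?z n)) / real n\<bar> \<le> \<bar>2 * B / real n\<bar>"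
          unfolding abs_divide by (intro divide_right_mono) auto
        have "(\<Sum>k<n. w (?z k) (?z (Suc k))) / real n - \<mu> =
            (\<Sum>k<n. d m (?z k) (?z (Suc k))) / real n + (h m (?z 0) - h m (?z n)) / real n
            + ((\<Sum>k<n. Q m (?z k)) / real n - \<mu>)"
          unfolding decomp by (simp add: add_divide_distrib)
        then show ?case
          using mean boundary elim unfolding dist_real_def by linarith
      qed
      then show ?case unfolding eventually_sequentially .
    qed
  qed
qed

section \<open>Ergodic and stationary means\<close>

text \<open>
  Duality between transporting a distribution forward and averaging a function backward.
\<close>

lemma sum_dist_at:
  "(\<Sum>y\<in>S. dist_at S P \<nu> n y * h y) = (\<Sum>x\<in>S. pmf \<nu> x * (mean_next S P ^^ n) h x)"
proof (induction n arbitrary: h)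
  case (Suc n)
  have "(\<Sum>y\<in>S. dist_at S P \<nu> (Suc n) y * h y) = (\<Sum>x\<in>S. dist_at S P \<nu> n x * mean_next S P h x)"
    unfolding mean_next_def dist_at.simps sum_distrib_right sum_distrib_left
    by (subst sum.swap) (simp add: mult.assoc)
  also have "\<dots> = (\<Sum>x\<in>S. pmf \<nu> x * (mean_next S P ^^ n) (mean_next S P h) x)"
    by (rule Suc.IH)
  finally show ?case by (simp only: funpow_Suc_right o_apply)
qed simp

lemma ergodic_stationary_unique:
  assumes "ergodic S P" "stationary S P \<pi>" "stationary S P \<pi>'"
  shows "\<pi>' = \<pi>"
  using assms unfolding ergodic_def by metis

lemma ergodic_mean_converges:
  assumes "ergodic S P" and "stationary S P \<pi>" and "finite S" and x: "x \<in> S"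
  shows "(\<lambda>n. (mean_next S P ^^ n) h x) \<longlonglongrightarrow> (\<Sum>y\<in>S. pmf \<pi> y * h y)"
proof -
  have "(\<lambda>n. dist_at S P (return_pmf x) n y) \<longlonglongrightarrow> pmf \<pi> y" if "y \<in> S" for y
    using assms(1,2) x that unfolding ergodic_def by (metis set_return_pmf empty_subsetI insert_subset)
  then have "(\<lambda>n. \<Sum>y\<in>S. dist_at S P (return_pmf x) n y * h y) \<longlonglongrightarrow> (\<Sum>y\<in>S. pmf \<pi> y * h y)"
    by (intro tendsto_sum tendsto_mult tendsto_const)
  moreover have "(\<Sum>y\<in>S. pmf (return_pmf x) y * g y) = g x" for g :: "'a \<Rightarrow> real"
    using x \<open>finite S\<close> by (simp add: indicator_def if_distrib sum.delta cong: if_cong)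
  ultimately show ?thesis unfolding sum_dist_at by simp
qed

lemma stationary_mean_next:
  assumes "stationary S P \<pi>"
  shows "(\<Sum>x\<in>S. pmf \<pi> x * mean_next S P h x) = (\<Sum>y\<in>S. pmf \<pi> y * h y)"
proof -
  have "(\<Sum>x\<in>S. pmf \<pi> x * mean_next S P h x) = (\<Sum>y\<in>S. (\<Sum>x\<in>S. pmf \<pi> x * P x y) * h y)"
    unfolding mean_next_def sum_distrib_right sum_distrib_left
    by (subst sum.swap) (simp add: mult.assoc)
  also have "\<dots> = (\<Sum>y\<in>S. pmf \<pi> y * h y)"
    using assms by (intro sum.cong) (simp_all add: stationary_def)
  finally show ?thesis .
qed

section \<open>Moves of the players and the augmented chain\<close>

lemma finite_configs [simp]: "finite (configs N)"
  by (auto simp: configs_def intro!: finite_PiE)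

lemma finite_configs_star [simp]: "finite (configs_star N)"
  by (simp add: configs_star_def)

lemma configs_01: "x \<in> configs N \<Longrightarrow> i \<in> {1..N} \<Longrightarrow> x i = 0 \<or> x i = 1"
  by (auto simp: configs_def PiE_iff)

lemma configs_update:
  "x \<in> configs N \<Longrightarrow> i \<in> {1..N} \<Longrightarrow> u \<in> {0, 1} \<Longrightarrow> x(i := u) \<in> configs N"
  by (auto simp: configs_def PiE_iff extensional_def)

lemma flip_in_configs: "x \<in> configs N \<Longrightarrow> i \<in> {1..N} \<Longrightarrow> flip i x \<in> configs N"
  using configs_01[of x N i] by (auto simp: flip_def intro!: configs_update)

lemma flip_neq [simp]: "flip i x \<noteq> x" "x \<noteq> flip i x"
  by (auto simp: flip_def fun_eq_iff intro!: exI[of _ i]) presburger+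

text \<open>
  The probability that player \<open>i\<close> moves \<open>x\<close> to \<open>y\<close> and a given player is next.  It is the same for
  every next player, so \<open>i\<close> serves as a representative; it is also the contribution of player \<open>i\<close>
  to the original transition matrix.
\<close>

definition play :: "nat \<Rightarrow> (nat \<Rightarrow> real) \<Rightarrow> nat \<Rightarrow> (nat \<Rightarrow> nat) \<Rightarrow> (nat \<Rightarrow> nat) \<Rightarrow> real" where
  "play N p i x y = trans_star N p (x, i) (y, i)"

lemma trans_star_eq_play: "trans_star N p (x, i) (y, j) = play N p i x y"
  by (simp add: play_def)

text \<open>
  On the diagonal, players whose status survives contribute, split by their status; off the diagonal,
  those whose flip produces \<open>y\<close>.
\<close>

lemma trans_mat_eq_sum_play:
  assumes x: "x \<in> configs N"
  shows "trans_mat N p x y = (\<Sum>i=1..N. play N p i x y)"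
proof (cases "y = x")
  case True
  have "{1..N} = {i \<in> {1..N}. x i = 0} \<union> {i \<in> {1..N}. x i = 1}"
    using configs_01[OF x] by blast
  then have "(\<Sum>i=1..N. play N p i x y) =
      (\<Sum>i\<in>{i \<in> {1..N}. x i = 0} \<union> {i \<in> {1..N}. x i = 1}. play N p i x y)"
    by (rule arg_cong)
  also have "\<dots> = (\<Sum>i | i \<in> {1..N} \<and> x i = 0. play N p i x y)
        + (\<Sum>i | i \<in> {1..N} \<and> x i = 1. play N p i x y)"
    by (intro sum.union_disjoint) auto
  finally show ?thesis
    using True by (simp add: trans_mat_def play_def distrib_left sum_distrib_left)
next
  case False
  then have "(\<Sum>i=1..N. play N p i x y) =
      (\<Sum>i=1..N. if y = flip i x
        then 1 / real N * (if x i = 0 then p (nbr N i x) else loss_prob p (nbr N i x)) else 0)"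
    by (intro sum.cong) (simp_all add: play_def)
  also have "\<dots> = trans_mat N p x y"
    using False unfolding trans_mat_def
    by (simp only: if_False) (subst sum.inter_filter[symmetric], simp_all)
  finally show ?thesis by simp
qed

text \<open>
  Heat bath form of a move: flipping and keeping conspire so that the new status of player \<open>i\<close> is
  \<open>1\<close> with probability \<open>p (nbr N i x)\<close> irrespective of \<open>x i\<close>.
\<close>

lemma sum_play:
  assumes x: "x \<in> configs N" and i: "i \<in> {1..N}"
  shows "(\<Sum>y\<in>configs N. play N p i x y * \<phi> y) =
    (p (nbr N i x) * \<phi> (x(i := 1)) + loss_prob p (nbr N i x) * \<phi> (x(i := 0))) / real N"
proof -
  have "(\<Sum>y\<in>configs N. play N p i x y * \<phi> y) = (\<Sum>y\<in>{x, flip i x}. play N p i x y * \<phi> y)"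
    using x flip_in_configs[OF x i] by (intro sum.mono_neutral_right) (auto simp: play_def)
  also have "\<dots> = play N p i x x * \<phi> x + play N p i x (flip i x) * \<phi> (flip i x)"
    by simp
  also have "\<dots> = (p (nbr N i x) * \<phi> (x(i := 1)) + loss_prob p (nbr N i x) * \<phi> (x(i := 0))) / real N"
    using configs_01[OF x i]
  proof
    assume "x i = 0"
    moreover from this have "flip i x = x(i := 1)" "x(i := 0) = x" by (auto simp: flip_def)
    ultimately show ?thesis
      using flip_neq(1)[of i x] by (simp add: play_def add_divide_distrib)
  next
    assume "x i = 1"
    moreover from this have "flip i x = x(i := 0)" "x(i := 1) = x" by (auto simp: flip_def)
    ultimately show ?thesis
      using flip_neq(1)[of i x] by (simp add: play_def add_divide_distrib)
  qed
  finally show ?thesis .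
qed

lemma mean_next_trans_mat:
  assumes x: "x \<in> configs N"
  shows "mean_next (configs N) (trans_mat N p) \<phi> x = (\<Sum>i=1..N. \<Sum>y\<in>configs N. play N p i x y * \<phi> y)"
  unfolding mean_next_def trans_mat_eq_sum_play[OF x] sum_distrib_right by (rule sum.swap)

lemma sum_configs_star:
  "(\<Sum>z\<in>configs_star N. g z) = (\<Sum>y\<in>configs N. \<Sum>j=1..N. g (y, j))"
  unfolding configs_star_def by (simp add: sum.cartesian_product)

lemma mean_next_trans_star:
  "mean_next (configs_star N) (trans_star N p) F (x, i) =
    (\<Sum>y\<in>configs N. play N p i x y * (\<Sum>j=1..N. F (y, j)))"
  unfolding mean_next_def sum_configs_star trans_star_eq_play by (simp add: sum_distrib_left)

text \<open>
  In one step the augmented chain depends on \<open>F\<close> only through its sum over the players, and summing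
  the moves over the current player recovers \<open>trans_mat\<close>; hence the sum over players intertwines the
  two operators.
\<close>

lemma sum_players_mean_next_star:
  assumes "x \<in> configs N"
  shows "(\<Sum>i=1..N. (mean_next (configs_star N) (trans_star N p) ^^ n) F (x, i)) =
    (mean_next (configs N) (trans_mat N p) ^^ n) (\<lambda>x. \<Sum>i=1..N. F (x, i)) x"
  using assms
proof (induction n arbitrary: x)
  case (Suc n)
  have "(\<Sum>i=1..N. (mean_next (configs_star N) (trans_star N p) ^^ Suc n) F (x, i)) =
    mean_next (configs N) (trans_mat N p)
      (\<lambda>y. \<Sum>j=1..N. (mean_next (configs_star N) (trans_star N p) ^^ n) F (y, j)) x"
    unfolding mean_next_trans_mat[OF Suc.prems] by (simp add: mean_next_trans_star)
  also have "\<dots> = mean_next (configs N) (trans_mat N p)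
      ((mean_next (configs N) (trans_mat N p) ^^ n) (\<lambda>x. \<Sum>i=1..N. F (x, i))) x"
    by (rule mean_next_cong) (rule Suc.IH)
  finally show ?case by simp
qed simp

text \<open>
  Ergodicity passes to the augmented chain at the cost of one step, which replaces the function of a
  player and a configuration by its sum over the players.
\<close>

lemma star_mean_converges:
  assumes erg: "ergodic (configs N) (trans_mat N p)"
    and st: "stationary (configs N) (trans_mat N p) \<pi>"
    and x: "x \<in> configs N" and i: "i \<in> {1..N}"
  shows "(\<lambda>n. (mean_next (configs_star N) (trans_star N p) ^^ n) F (x, i)) \<longlonglongrightarrow>
    1 / real N * (\<Sum>y\<in>configs N. pmf \<pi> y * (\<Sum>j=1..N. F (y, j)))" (is "_ \<longlonglongrightarrow> 1 / real N * ?m")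
proof (rule LIMSEQ_imp_Suc)
  have "(mean_next (configs_star N) (trans_star N p) ^^ Suc n) F (x, i) =
      (\<Sum>y\<in>configs N. play N p i x y *
        (mean_next (configs N) (trans_mat N p) ^^ n) (\<lambda>x. \<Sum>i=1..N. F (x, i)) y)" for n
    by (simp add: mean_next_trans_star sum_players_mean_next_star del: One_nat_def)
  moreover have "(\<lambda>n. \<Sum>y\<in>configs N. play N p i x y *
        (mean_next (configs N) (trans_mat N p) ^^ n) (\<lambda>x. \<Sum>i=1..N. F (x, i)) y)
      \<longlonglongrightarrow> (\<Sum>y\<in>configs N. play N p i x y * ?m)"
    by (intro tendsto_sum tendsto_mult tendsto_const ergodic_mean_converges[OF erg st] finite_configs)
  \<comment> \<open>The factor \<open>1 / N\<close> is the total mass of the moves of \<open>i\<close> with a given next player.\<close>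
  moreover have "(\<Sum>y\<in>configs N. play N p i x y * ?m) = 1 / real N * ?m"
    unfolding sum_play[OF x i] by (simp add: algebra_simps)
  ultimately show "(\<lambda>n. (mean_next (configs_star N) (trans_star N p) ^^ Suc n) F (x, i))
      \<longlonglongrightarrow> 1 / real N * ?m"
    by simp
qed

lemma mean_payoff:
  assumes x: "x \<in> configs N" and i: "i \<in> {1..N}"
  shows "(\<Sum>z\<in>configs_star N. trans_star N p (x, i) z * payoff (x, i) z) =
    p (nbr N i x) - loss_prob p (nbr N i x)"
proof -
  have "(\<Sum>z\<in>configs_star N. trans_star N p (x, i) z * payoff (x, i) z) =
    (\<Sum>y\<in>configs N. play N p i x y * (\<Sum>j=1..N. payoff (x, i) (y, j)))"
    using mean_next_trans_star[of N p "payoff (x, i)" x i] by (simp add: mean_next_def)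
  also have "\<dots> = (p (nbr N i x) * (\<Sum>j=1..N. payoff (x, i) (x(i := 1), j))
      + loss_prob p (nbr N i x) * (\<Sum>j=1..N. payoff (x, i) (x(i := 0), j))) / real N"
    by (rule sum_play[OF x i])
  also have "payoff (x, i) (x(i := u), j) = (if u = 1 then 1 else -1)" if "u \<in> {0, 1}" for u j
    using configs_01[OF x i] that
    by (subst payoff_alt[of x i N]) (use x i in \<open>auto simp: configs_star_def flip_def\<close>)
  then have "(p (nbr N i x) * (\<Sum>j=1..N. payoff (x, i) (x(i := 1), j))
      + loss_prob p (nbr N i x) * (\<Sum>j=1..N. payoff (x, i) (x(i := 0), j))) / real N
      = p (nbr N i x) - loss_prob p (nbr N i x)"
    using i by (simp add: field_simps)
  finally show ?thesis .
qed

section \<open>Rotation invariance\<close>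

definition rotate_config :: "nat \<Rightarrow> (nat \<Rightarrow> nat) \<Rightarrow> (nat \<Rightarrow> nat)" where
  "rotate_config N x = (\<lambda>i\<in>{1..N}. x (cyc N (i + 1)))"

lemma bij_cyc_succ: "bij_betw (\<lambda>i. cyc N (i + 1)) {1..N} {1..N}"
  by (rule bij_betw_byWitness[where f' = "\<lambda>i. cyc N (i - 1)"]) (auto simp: cyc_def)

lemma cyc_succ_in: "i \<in> {1..N} \<Longrightarrow> cyc N (i + 1) \<in> {1..N}"
  using bij_betwE[OF bij_cyc_succ] by blast

lemma rotate_config_in: "x \<in> configs N \<Longrightarrow> rotate_config N x \<in> configs N"
  using cyc_succ_in[of _ N] unfolding configs_def rotate_config_def by (auto simp: PiE_iff)

text \<open>
  Injectivity turns the equations between configurations that select entries of the transition matrix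
  into equations between their rotations.
\<close>

lemma inj_rotate_config: "inj_on (rotate_config N) (configs N)"
proof (rule inj_onI)
  fix x y assume x: "x \<in> configs N" and y: "y \<in> configs N"
    and eq: "rotate_config N x = rotate_config N y"
  have "x j = y j" if "j \<in> {1..N}" for j
  proof -
    obtain i where "i \<in> {1..N}" "j = cyc N (i + 1)"
      using \<open>j \<in> {1..N}\<close> bij_betw_imp_surj_on[OF bij_cyc_succ] by blast
    then show ?thesis using fun_cong[OF eq, of i] by (simp add: rotate_config_def)
  qed
  then show "x = y" using x y unfolding configs_def by (intro PiE_ext) auto
qed

lemma bij_rotate_config: "bij_betw (rotate_config N) (configs N) (configs N)"
  unfolding bij_betw_def
  using inj_rotate_config rotate_config_in
  by (auto intro!: endo_inj_surj[OF finite_configs])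

lemma nbr_rotate:
  assumes "i \<in> {1..N}"
  shows "nbr N i (rotate_config N x) = nbr N (cyc N (i + 1)) x"
proof -
  have "cyc N (i - 1) \<in> {1..N}" "cyc N (cyc N (i - 1) + 1) = cyc N (cyc N (i + 1) - 1)"
    using assms by (auto simp: cyc_def)
  then show ?thesis
    using cyc_succ_in[OF assms] by (simp add: nbr_def rotate_config_def)
qed

lemma flip_rotate:
  assumes "i \<in> {1..N}"
  shows "flip i (rotate_config N x) = rotate_config N (flip (cyc N (i + 1)) x)"
proof
  fix j
  have "cyc N (j + 1) = cyc N (i + 1) \<longleftrightarrow> j = i" if "j \<in> {1..N}"
    using inj_onD[OF bij_betw_imp_inj_on[OF bij_cyc_succ]] that assms by blast
  then show "flip i (rotate_config N x) j = rotate_config N (flip (cyc N (i + 1)) x) j"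
    using assms by (cases "j \<in> {1..N}") (auto simp: flip_def rotate_config_def)
qed

lemma play_rotate:
  assumes "i \<in> {1..N}" and x: "x \<in> configs N" and y: "y \<in> configs N"
  shows "play N p i (rotate_config N x) (rotate_config N y) = play N p (cyc N (i + 1)) x y"
proof -
  have "flip (cyc N (i + 1)) x \<in> configs N"
    using flip_in_configs[OF x] cyc_succ_in[OF assms(1)] by blast
  then have "rotate_config N y = flip i (rotate_config N x) \<longleftrightarrow> y = flip (cyc N (i + 1)) x"
    unfolding flip_rotate[OF assms(1)] using inj_onD[OF inj_rotate_config] y by blast
  moreover have "rotate_config N y = rotate_config N x \<longleftrightarrow> y = x"
    using inj_onD[OF inj_rotate_config] x y by blast
  moreover have "rotate_config N x i = x (cyc N (i + 1))"
    using assms(1) by (simp add: rotate_config_def)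
  ultimately show ?thesis
    using nbr_rotate[OF assms(1), of x] by (simp add: play_def)
qed

lemma trans_mat_rotate:
  assumes x: "x \<in> configs N" and y: "y \<in> configs N"
  shows "trans_mat N p (rotate_config N x) (rotate_config N y) = trans_mat N p x y"
proof -
  have "trans_mat N p (rotate_config N x) (rotate_config N y)
      = (\<Sum>i=1..N. play N p (cyc N (i + 1)) x y)"
    unfolding trans_mat_eq_sum_play[OF rotate_config_in[OF x]]
    by (intro sum.cong refl play_rotate x y)
  also have "\<dots> = trans_mat N p x y"
    unfolding trans_mat_eq_sum_play[OF x] by (rule sum.reindex_bij_betw[OF bij_cyc_succ])
  finally show ?thesis .
qed

text \<open>
  The rotation is an automorphism of the transition matrix, so it carries a stationary distribution
  to a stationary distribution, and there is only one.
\<close>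

lemma stationary_rotate_invariant:
  assumes erg: "ergodic (configs N) (trans_mat N p)"
    and st: "stationary (configs N) (trans_mat N p) \<pi>"
  shows "map_pmf (rotate_config N) \<pi> = \<pi>"
proof (rule ergodic_stationary_unique[OF erg st])
  have supp: "set_pmf \<pi> \<subseteq> configs N" using st by (simp add: stationary_def)
  have pmf_rot: "pmf (map_pmf (rotate_config N) \<pi>) (rotate_config N x) = pmf \<pi> x"
    if x: "x \<in> configs N" for x
  proof (cases "x \<in> set_pmf \<pi>")
    case True
    then show ?thesis by (intro pmf_map_inj inj_on_subset[OF inj_rotate_config supp])
  next
    case False
    then have "rotate_config N x \<notin> rotate_config N ` set_pmf \<pi>"
      using inj_on_image_mem_iff[OF inj_rotate_config x supp] by simp
    then show ?thesis using False by (simp add: pmf_map_outside pmf_eq_0_set_pmf)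
  qed
  show "stationary (configs N) (trans_mat N p) (map_pmf (rotate_config N) \<pi>)"
    unfolding stationary_def
  proof (intro conjI ballI)
    show "set_pmf (map_pmf (rotate_config N) \<pi>) \<subseteq> configs N"
      using supp rotate_config_in by auto
    fix y' assume "y' \<in> configs N"
    then obtain y where y: "y \<in> configs N" "y' = rotate_config N y"
      using bij_betw_imp_surj_on[OF bij_rotate_config] by blast
    have "(\<Sum>x\<in>configs N. pmf (map_pmf (rotate_config N) \<pi>) x * trans_mat N p x y') =
        (\<Sum>x\<in>configs N. pmf (map_pmf (rotate_config N) \<pi>) (rotate_config N x) *
          trans_mat N p (rotate_config N x) y')"
      by (rule sum.reindex_bij_betw[OF bij_rotate_config, symmetric])
    also have "\<dots> = (\<Sum>x\<in>configs N. pmf \<pi> x * trans_mat N p x y)"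
      using y by (intro sum.cong) (simp_all add: pmf_rot trans_mat_rotate)
    also have "\<dots> = pmf (map_pmf (rotate_config N) \<pi>) y'"
      using st y by (simp add: stationary_def pmf_rot)
    finally show "(\<Sum>x\<in>configs N. pmf (map_pmf (rotate_config N) \<pi>) x * trans_mat N p x y') =
        pmf (map_pmf (rotate_config N) \<pi>) y'" .
  qed
qed

lemma marg2_rotate:
  assumes inv: "map_pmf (rotate_config N) \<pi> = \<pi>" and "i \<in> {1..N}" "j \<in> {1..N}"
  shows "marg2 \<pi> i j u v = marg2 \<pi> (cyc N (i + 1)) (cyc N (j + 1)) u v"
proof -
  have "marg2 \<pi> i j u v = measure_pmf.prob (map_pmf (rotate_config N) \<pi>) {x. x i = u \<and> x j = v}"
    by (simp add: marg2_def inv)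
  also have "\<dots> = marg2 \<pi> (cyc N (i + 1)) (cyc N (j + 1)) u v"
    using assms(2,3) by (simp add: marg2_def vimage_def rotate_config_def)
  finally show ?thesis .
qed

text \<open>As a degenerate pair, a single site inherits the facts on two-dimensional marginals.\<close>

lemma marg1_eq_marg2: "marg1 \<pi> i u = marg2 \<pi> i i u u"
  by (simp add: marg1_def marg2_def)

lemma marg1_homogeneous:
  assumes inv: "map_pmf (rotate_config N) \<pi> = \<pi>" and "i \<in> {1..N}"
  shows "marg1 \<pi> i u = marg1 \<pi> 1 u"
proof -
  have "1 \<le> i" using assms(2) by simp
  then have "i \<le> N \<longrightarrow> marg1 \<pi> i u = marg1 \<pi> 1 u"
  proof (induction i rule: dec_induct)
    case (step i)
    show ?case
    proof
      assume "Suc i \<le> N"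
      with step have "marg1 \<pi> i u = marg1 \<pi> (Suc i) u"
        unfolding marg1_eq_marg2 by (subst marg2_rotate[OF inv]) (auto simp: cyc_def)
      with step \<open>Suc i \<le> N\<close> show "marg1 \<pi> (Suc i) u = marg1 \<pi> 1 u" by simp
    qed
  qed simp
  with assms(2) show ?thesis by simp
qed

lemma marg2_homogeneous:
  assumes inv: "map_pmf (rotate_config N) \<pi> = \<pi>" and "N \<ge> 3" and "i \<in> {1..N}"
  shows "marg2 \<pi> i (cyc N (i + 2)) u v = marg2 \<pi> 1 3 u v"
proof -
  have "1 \<le> i" using assms(3) by simp
  then have "i \<le> N \<longrightarrow> marg2 \<pi> i (cyc N (i + 2)) u v = marg2 \<pi> 1 3 u v"
  proof (induction i rule: dec_induct)
    case base
    show ?case using \<open>N \<ge> 3\<close> by (simp add: cyc_def numeral_3_eq_3)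
  next
    case (step i)
    show ?case
    proof
      assume le: "Suc i \<le> N"
      with step \<open>N \<ge> 3\<close> have "cyc N (i + 2) \<in> {1..N}" "cyc N (i + 1) = Suc i"
        "cyc N (cyc N (i + 2) + 1) = cyc N (Suc i + 2)"
        by (auto simp: cyc_def)
      then have "marg2 \<pi> i (cyc N (i + 2)) u v = marg2 \<pi> (Suc i) (cyc N (Suc i + 2)) u v"
        using marg2_rotate[OF inv, of i "cyc N (i + 2)" u v] step le by simp
      with step le show "marg2 \<pi> (Suc i) (cyc N (Suc i + 2)) u v = marg2 \<pi> 1 3 u v" by simp
    qed
  qed
  with assms(3) show ?thesis by simp
qed

section \<open>Marginals of the stationary distribution\<close>

lemma marg2_eq_sum:
  assumes "set_pmf \<pi> \<subseteq> configs N"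
  shows "marg2 \<pi> i j u v = (\<Sum>x\<in>configs N. pmf \<pi> x * of_bool (x i = u \<and> x j = v))"
proof -
  have "marg2 \<pi> i j u v = measure_pmf.prob \<pi> {x \<in> configs N. x i = u \<and> x j = v}"
  proof -
    have "{x. x i = u \<and> x j = v} \<inter> set_pmf \<pi> = {x \<in> configs N. x i = u \<and> x j = v} \<inter> set_pmf \<pi>"
      using assms by blast
    then show ?thesis
      using measure_Int_set_pmf[of \<pi> "{x. x i = u \<and> x j = v}"]
        measure_Int_set_pmf[of \<pi> "{x \<in> configs N. x i = u \<and> x j = v}"]
      unfolding marg2_def by simp
  qed
  also have "\<dots> = (\<Sum>x\<in>{x \<in> configs N. x i = u \<and> x j = v}. pmf \<pi> x)"
    by (rule measure_measure_pmf_finite) simp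
  also have "\<dots> = (\<Sum>x\<in>configs N. pmf \<pi> x * of_bool (x i = u \<and> x j = v))"
    by (rule sum.mono_neutral_cong_left) auto
  finally show ?thesis .
qed

lemma expectation_eq_marg2:
  fixes g :: "nat \<Rightarrow> nat \<Rightarrow> real"
  assumes "set_pmf \<pi> \<subseteq> configs N" and i: "i \<in> {1..N}" and j: "j \<in> {1..N}"
  shows "(\<Sum>x\<in>configs N. pmf \<pi> x * g (x i) (x j)) =
    marg2 \<pi> i j 0 0 * g 0 0 + marg2 \<pi> i j 0 1 * g 0 1 +
    marg2 \<pi> i j 1 0 * g 1 0 + marg2 \<pi> i j 1 1 * g 1 1"
proof -
  have "pmf \<pi> x * g (x i) (x j) =
      pmf \<pi> x * of_bool (x i = 0 \<and> x j = 0) * g 0 0 + pmf \<pi> x * of_bool (x i = 0 \<and> x j = 1) * g 0 1 +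
      pmf \<pi> x * of_bool (x i = 1 \<and> x j = 0) * g 1 0 + pmf \<pi> x * of_bool (x i = 1 \<and> x j = 1) * g 1 1"
    if "x \<in> configs N" for x
    using configs_01[OF that i] configs_01[OF that j] by auto
  then show ?thesis
    unfolding marg2_eq_sum[OF assms(1)] sum_distrib_right sum.distrib[symmetric]
    by (rule sum.cong[OF refl])
qed

text \<open>
  A move of another player leaves the status of \<open>i\<close> alone, and a move of \<open>i\<close> redraws it with
  success probability \<open>p (nbr N i x)\<close>.  In the stationary balance for the event \<open>x i = 1\<close> the
  contributions of the other \<open>N - 1\<close> players cancel.
\<close>

lemma marg1_eq_mean_win:
  assumes st: "stationary (configs N) (trans_mat N p) \<pi>" and i: "i \<in> {1..N}"
  shows "marg1 \<pi> i 1 = (\<Sum>x\<in>configs N. pmf \<pi> x * p (nbr N i x))"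
proof -
  define h :: "(nat \<Rightarrow> nat) \<Rightarrow> real" where "h x = of_bool (x i = 1)" for x
  define m where "m = marg1 \<pi> i 1"
  have supp: "set_pmf \<pi> \<subseteq> configs N" using st by (simp add: stationary_def)
  have m: "m = (\<Sum>x\<in>configs N. pmf \<pi> x * h x)"
    unfolding m_def h_def marg1_eq_marg2 marg2_eq_sum[OF supp] by simp
  have "mean_next (configs N) (trans_mat N p) h x = (p (nbr N i x) + (real N - 1) * h x) / real N"
    if x: "x \<in> configs N" for x
  proof -
    have "mean_next (configs N) (trans_mat N p) h x =
        (\<Sum>k=1..N. (p (nbr N k x) * h (x(k := 1)) + loss_prob p (nbr N k x) * h (x(k := 0))) / real N)"
      unfolding mean_next_trans_mat[OF x] by (intro sum.cong refl sum_play x)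
    also have "\<dots> = (\<Sum>k=1..N. (if k = i then p (nbr N i x) else h x) / real N)"
      by (intro sum.cong) (auto simp: h_def algebra_simps)
    also have "\<dots> = (p (nbr N i x) + (\<Sum>k\<in>{1..N} - {i}. h x)) / real N"
      unfolding sum_divide_distrib[symmetric] using i by (subst sum.remove[of _ i]) auto
    also have "(\<Sum>k\<in>{1..N} - {i}. h x) = (real N - 1) * h x"
      using i by (simp add: of_nat_diff)
    finally show ?thesis .
  qed
  then have "(\<Sum>x\<in>configs N. pmf \<pi> x * mean_next (configs N) (trans_mat N p) h x)
      = (\<Sum>x\<in>configs N. pmf \<pi> x * ((p (nbr N i x) + (real N - 1) * h x) / real N))"
    by (intro sum.cong) simp_all
  then have "m = (\<Sum>x\<in>configs N. pmf \<pi> x * ((p (nbr N i x) + (real N - 1) * h x) / real N))"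
    unfolding stationary_mean_next[OF st] m .
  also have "\<dots> = ((\<Sum>x\<in>configs N. pmf \<pi> x * p (nbr N i x)) + (real N - 1) * m) / real N"
    unfolding m sum_distrib_left sum.distrib[symmetric] sum_divide_distrib
    by (intro sum.cong) (auto simp: algebra_simps)
  finally have "m * real N = (\<Sum>x\<in>configs N. pmf \<pi> x * p (nbr N i x)) + (real N - 1) * m"
    using i by (subst (asm) eq_divide_eq) auto
  then show ?thesis
    by (simp add: m_def algebra_simps)
qed

section \<open>The mean parameter\<close>

theorem theorem5:
  fixes N :: nat and p :: "nat \<Rightarrow> real" and \<pi> :: "(nat \<Rightarrow> nat) pmf"
    and M :: "'w measure" and X :: "nat \<Rightarrow> 'w \<Rightarrow> nat \<Rightarrow> nat" and I :: "nat \<Rightarrow> 'w \<Rightarrow> nat"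
    and \<xi> :: "nat \<Rightarrow> 'w \<Rightarrow> real" and S :: "nat \<Rightarrow> 'w \<Rightarrow> real"
  assumes "N \<ge> 3"
    and "\<And>m. m \<in> {0..3} \<Longrightarrow> p m \<in> {0..1}"
    and "ergodic (configs N) (trans_mat N p)"
    and "stationary (configs N) (trans_mat N p) \<pi>"
    and "markov_chain M (configs_star N) (trans_star N p) (\<lambda>n \<omega>. (X n \<omega>, I n \<omega>))"
    and "\<And>n \<omega>. n \<ge> 1 \<Longrightarrow> \<xi> n \<omega> = payoff (X (n - 1) \<omega>, I (n - 1) \<omega>) (X n \<omega>, I n \<omega>)"
    and "\<And>n \<omega>. n \<ge> 1 \<Longrightarrow> S n \<omega> = (\<Sum>k=1..n. \<xi> k \<omega>)"
  shows "(\<forall>i\<in>{1..N}. \<forall>u\<in>{0, 1}. \<forall>v\<in>{0, 1}. marg2 \<pi> i (cyc N (i + 2)) u v = marg2 \<pi> 1 3 u v) \<and>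
    (\<forall>i\<in>{1..N}. \<forall>u\<in>{0, 1}. marg1 \<pi> i u = marg1 \<pi> 1 u) \<and>
    (\<exists>\<mu> :: real.
      (AE \<omega> in M. (\<lambda>n. S n \<omega> / real n) \<longlonglongrightarrow> \<mu>) \<and>
      \<mu> = 1 / real N * (\<Sum>x\<in>configs N. pmf \<pi> x *
             (\<Sum>i=1..N. p (nbr N i x) - loss_prob p (nbr N i x))) \<and>
      \<mu> = (\<Sum>u=0..1. \<Sum>v=0..1. marg2 \<pi> 1 3 u v * (p (2 * u + v) - loss_prob p (2 * u + v))) \<and>
      \<mu> = 2 * (marg2 \<pi> 1 3 0 0 * p 0 + marg2 \<pi> 1 3 0 1 * p 1 +
               marg2 \<pi> 1 3 1 0 * p 2 + marg2 \<pi> 1 3 1 1 * p 3) - 1 \<and>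
      \<mu> = marg1 \<pi> 1 1 - marg1 \<pi> 1 0 \<and>
      \<mu> = 2 * marg1 \<pi> 1 1 - 1)"
proof -
  note erg = assms(3) and st = assms(4)
  have supp: "set_pmf \<pi> \<subseteq> configs N" using st by (simp add: stationary_def)
  have inv: "map_pmf (rotate_config N) \<pi> = \<pi>"
    by (rule stationary_rotate_invariant[OF erg st])
  define \<mu> where "\<mu> = 1 / real N * (\<Sum>x\<in>configs N. pmf \<pi> x *
             (\<Sum>i=1..N. p (nbr N i x) - loss_prob p (nbr N i x)))"
  let ?w = "\<lambda>k \<omega>. payoff (X k \<omega>, I k \<omega>) (X (Suc k) \<omega>, I (Suc k) \<omega>)"
  have "(\<lambda>n. (mean_next (configs_star N) (trans_star N p) ^^ n)
      (\<lambda>z. \<Sum>z'\<in>configs_star N. trans_star N p z z' * payoff z z') (x, i)) \<longlonglongrightarrow> \<mu>"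
    if "(x, i) \<in> configs_star N" for x i
  proof -
    have "\<mu> = 1 / real N * (\<Sum>y\<in>configs N. pmf \<pi> y *
        (\<Sum>j=1..N. \<Sum>z'\<in>configs_star N. trans_star N p (y, j) z' * payoff (y, j) z'))"
      unfolding \<mu>_def by (simp add: mean_payoff)
    then show ?thesis
      using star_mean_converges[OF erg st, of x i] that by (simp add: configs_star_def)
  qed
  then have "AE \<omega> in M. (\<lambda>n. (\<Sum>k<n. ?w k \<omega>) / real n) \<longlonglongrightarrow> \<mu>"
    using markov_chain_slln[OF assms(5), of payoff \<mu>] by auto
  moreover have "(\<lambda>n. S n \<omega> / real n) \<longlonglongrightarrow> \<mu>"
    if "(\<lambda>n. (\<Sum>k<n. ?w k \<omega>) / real n) \<longlonglongrightarrow> \<mu>" for \<omega>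
  proof (rule Lim_transform_eventually[OF that])
    show "\<forall>\<^sub>F n in sequentially. (\<Sum>k<n. ?w k \<omega>) / real n = S n \<omega> / real n"
      using eventually_ge_at_top[of 1]
    proof eventually_elim
      case (elim n)
      have "S n \<omega> = (\<Sum>k=1..n. payoff (X (k - 1) \<omega>, I (k - 1) \<omega>) (X k \<omega>, I k \<omega>))"
        unfolding assms(7)[OF elim] by (intro sum.cong) (simp_all add: assms(6))
      also have "\<dots> = (\<Sum>k<n. ?w k \<omega>)"
        by (rule sum.reindex_bij_witness[of _ Suc "\<lambda>k. k - 1"]) auto
      finally show ?case by simp
    qed
  qed
  ultimately have slln: "AE \<omega> in M. (\<lambda>n. S n \<omega> / real n) \<longlonglongrightarrow> \<mu>"
    by auto
  have mass: "(\<Sum>x\<in>configs N. pmf \<pi> x) = 1"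
    by (rule sum_pmf_eq_1[OF finite_configs supp])
  have "\<mu> = 1 / real N * (\<Sum>i=1..N. 2 * (\<Sum>x\<in>configs N. pmf \<pi> x * p (nbr N i x))
      - (\<Sum>x\<in>configs N. pmf \<pi> x))"
    unfolding \<mu>_def sum_distrib_left sum_subtractf[symmetric]
    by (subst (2) sum.swap) (simp add: algebra_simps)
  also have "\<dots> = 1 / real N * (\<Sum>i=1..N. 2 * marg1 \<pi> 1 1 - 1)"
  proof -
    have "2 * (\<Sum>x\<in>configs N. pmf \<pi> x * p (nbr N i x)) - (\<Sum>x\<in>configs N. pmf \<pi> x)
        = 2 * marg1 \<pi> 1 1 - 1" if "i \<in> {1..N}" for i
      unfolding mass marg1_eq_mean_win[OF st that, symmetric] marg1_homogeneous[OF inv that] ..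
    then show ?thesis by simp
  qed
  finally have \<mu>_marg1: "\<mu> = 2 * marg1 \<pi> 1 1 - 1"
    using \<open>N \<ge> 3\<close> by simp
  \<comment> \<open>Player \<open>2\<close> is the one whose neighbours are \<open>1\<close> and \<open>3\<close>.\<close>
  have "marg1 \<pi> 1 1 = (\<Sum>x\<in>configs N. pmf \<pi> x * p (2 * x 1 + x 3))"
    using marg1_homogeneous[OF inv, of 2] marg1_eq_mean_win[OF st, of 2] \<open>N \<ge> 3\<close>
    by (simp add: nbr_def cyc_def)
  then have win: "marg1 \<pi> 1 1 = marg2 \<pi> 1 3 0 0 * p 0 + marg2 \<pi> 1 3 0 1 * p 1 +
               marg2 \<pi> 1 3 1 0 * p 2 + marg2 \<pi> 1 3 1 1 * p 3"
    using expectation_eq_marg2[OF supp, of 1 3 "\<lambda>u v. p (2 * u + v)"] \<open>N \<ge> 3\<close> by simp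
  have total: "marg2 \<pi> 1 3 0 0 + marg2 \<pi> 1 3 0 1 + marg2 \<pi> 1 3 1 0 + marg2 \<pi> 1 3 1 1 = 1"
    using expectation_eq_marg2[OF supp, of 1 3 "\<lambda>u v. 1"] \<open>N \<ge> 3\<close> mass by simp
  have compl: "marg1 \<pi> 1 0 + marg1 \<pi> 1 1 = 1"
    using expectation_eq_marg2[OF supp, of 1 1 "\<lambda>u v. of_bool (u = v)"] \<open>N \<ge> 3\<close> mass
    by (simp add: marg1_eq_marg2 del: One_nat_def)
  have "(\<Sum>u=0..1. \<Sum>v=0..1. marg2 \<pi> 1 3 u v * (p (2 * u + v) - loss_prob p (2 * u + v)))
      = 2 * (marg2 \<pi> 1 3 0 0 * p 0 + marg2 \<pi> 1 3 0 1 * p 1 +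
               marg2 \<pi> 1 3 1 0 * p 2 + marg2 \<pi> 1 3 1 1 * p 3)
        - (marg2 \<pi> 1 3 0 0 + marg2 \<pi> 1 3 0 1 + marg2 \<pi> 1 3 1 0 + marg2 \<pi> 1 3 1 1)"
  proof -
    have "{0..1::nat} = {0, 1}" by auto
    then show ?thesis by (simp add: algebra_simps del: One_nat_def)
  qed
  then have
    "\<mu> = (\<Sum>u=0..1. \<Sum>v=0..1. marg2 \<pi> 1 3 u v * (p (2 * u + v) - loss_prob p (2 * u + v)))"
    using \<mu>_marg1 win total by simp
  moreover have "\<mu> = marg1 \<pi> 1 1 - marg1 \<pi> 1 0"
    using \<mu>_marg1 compl by linarith
  moreover have "\<mu> = 2 * (marg2 \<pi> 1 3 0 0 * p 0 + marg2 \<pi> 1 3 0 1 * p 1 +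
               marg2 \<pi> 1 3 1 0 * p 2 + marg2 \<pi> 1 3 1 1 * p 3) - 1"
    using \<mu>_marg1 win by simp
  moreover have "\<forall>i\<in>{1..N}. \<forall>u\<in>{0, 1}. marg1 \<pi> i u = marg1 \<pi> 1 u"
    by (intro ballI marg1_homogeneous[OF inv])
  moreover have "\<forall>i\<in>{1..N}. \<forall>u\<in>{0, 1}. \<forall>v\<in>{0, 1}.
      marg2 \<pi> i (cyc N (i + 2)) u v = marg2 \<pi> 1 3 u v"
    by (intro ballI marg2_homogeneous[OF inv \<open>N \<ge> 3\<close>])
  ultimately show ?thesis
    using slln \<mu>_def \<mu>_marg1 by blast
qed

end
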